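(* Assume Martin's axiom (MA). Then every $\aleph_2$-free abelian group of cardinality $< 2^{\aleph_0}$ is separable.
   Context: Groups are abelian. For an uncountable cardinal $\kappa$, an abelian group is $\kappa$-free if all its subgroups of cardinality $<\kappa$ are free abelian; thus $\aleph_1$-free means that all countable subgroups are free, and $\aleph_2$-free means that all subgroups of cardinality at most $\aleph_1$ are free. An $\aleph_1$-free group is called separable if each of its pure cyclic subgroups is a direct summand. Martin's axiom: for every nonempty partially ordered set $P$ satisfying the countable (anti)chain condition and every family of fewer than $2^{\aleph_0}$ dense subsets of $P$, there is a filter in $P$ meeting every member of the family. *)

theory Defs
  imports "HOL-Algebra.Free_Abelian_Groups" "HOL-Library.Countable_Set"
begin

unbundle cardinal_syntax

text \<open>Cardinals are the cardinal orders of Main; \<open>|A|\<close> is the cardinal of the set \<open>A\<close>.\<close>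

abbreviation aleph1 :: "nat set rel"
  where "aleph1 \<equiv> cardSuc natLeq"

abbreviation aleph2 :: "nat set set rel"
  where "aleph2 \<equiv> cardSuc aleph1"

abbreviation continuum :: "nat set rel"
  where "continuum \<equiv> |UNIV :: nat set set|"


section \<open>Martin's axiom\<close>

text \<open>A poset is a carrier \<open>P\<close> with a relation \<open>r\<close> such that \<open>partial_order_on P r\<close>;
  \<open>(q, p) \<in> r\<close> reads \<open>q \<le> p\<close>, i.e. \<open>q\<close> is the stronger condition.\<close>

definition poset_compatible :: "'p set \<Rightarrow> 'p rel \<Rightarrow> 'p \<Rightarrow> 'p \<Rightarrow> bool"
  where "poset_compatible P r p q \<longleftrightarrow> (\<exists>s\<in>P. (s, p) \<in> r \<and> (s, q) \<in> r)"

text \<open>Antichains are in the sense of forcing: pairwise incompatible, not merely incomparable.\<close>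

definition poset_antichain :: "'p set \<Rightarrow> 'p rel \<Rightarrow> 'p set \<Rightarrow> bool"
  where "poset_antichain P r A \<longleftrightarrow>
    A \<subseteq> P \<and> (\<forall>p\<in>A. \<forall>q\<in>A. p \<noteq> q \<longrightarrow> \<not> poset_compatible P r p q)"

definition ccc :: "'p set \<Rightarrow> 'p rel \<Rightarrow> bool"
  where "ccc P r \<longleftrightarrow> (\<forall>A. poset_antichain P r A \<longrightarrow> countable A)"

definition poset_dense :: "'p set \<Rightarrow> 'p rel \<Rightarrow> 'p set \<Rightarrow> bool"
  where "poset_dense P r D \<longleftrightarrow> D \<subseteq> P \<and> (\<forall>p\<in>P. \<exists>q\<in>D. (q, p) \<in> r)"

definition poset_filter :: "'p set \<Rightarrow> 'p rel \<Rightarrow> 'p set \<Rightarrow> bool"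
  where "poset_filter P r F \<longleftrightarrow>
    F \<subseteq> P \<and> F \<noteq> {} \<and>
    (\<forall>p\<in>F. \<forall>q\<in>P. (p, q) \<in> r \<longrightarrow> q \<in> F) \<and>
    (\<forall>p\<in>F. \<forall>q\<in>F. \<exists>s\<in>F. (s, p) \<in> r \<and> (s, q) \<in> r)"

text \<open>HOL cannot quantify over types inside a formula, so the posets range over all carriers
  inside one type of cardinality \<open>2\<^sup>\<aleph>\<^sup>0\<close>: up to isomorphism these are all posets of cardinality
  at most \<open>2\<^sup>\<aleph>\<^sup>0\<close>. The axiom for arbitrary posets implies this one (and conversely, by the usual
  reduction to posets of cardinality less than \<open>2\<^sup>\<aleph>\<^sup>0\<close>), so assuming it is never more than
  assuming Martin's axiom. The order \<open>r\<close> is unrelated to inclusion on \<^typ>\<open>nat set\<close>.\<close>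

definition martins_axiom :: bool
  where "martins_axiom \<longleftrightarrow>
    (\<forall>(P :: nat set set) r. P \<noteq> {} \<and> partial_order_on P r \<and> ccc P r \<longrightarrow>
      (\<forall>\<D>. |\<D>| <o continuum \<and> (\<forall>D\<in>\<D>. poset_dense P r D) \<longrightarrow>
        (\<exists>F. poset_filter P r F \<and> (\<forall>D\<in>\<D>. F \<inter> D \<noteq> {}))))"


section \<open>Abelian groups\<close>

text \<open>Groups are written multiplicatively, as in \<^theory>\<open>HOL-Algebra.Group\<close>. Taking the
  generating set \<open>S\<close> in the element type of the group loses nothing, since a basis of a free
  abelian group is a subset of it.\<close>

definition is_free_abelian :: "('a, 'b) monoid_scheme \<Rightarrow> bool"
  where "is_free_abelian G \<longleftrightarrow> (\<exists>S :: 'a set. G \<cong> free_Abelian_group S)"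

definition kappa_free :: "'k rel \<Rightarrow> ('a, 'b) monoid_scheme \<Rightarrow> bool"
  where "kappa_free \<kappa> G \<longleftrightarrow>
    (\<forall>H. subgroup H G \<and> |H| <o \<kappa> \<longrightarrow> is_free_abelian (G\<lparr>carrier := H\<rparr>))"

definition pure_subgroup :: "'a set \<Rightarrow> ('a, 'b) monoid_scheme \<Rightarrow> bool"
  where "pure_subgroup H G \<longleftrightarrow> subgroup H G \<and>
    (\<forall>n::nat. \<forall>h\<in>H. (\<exists>g\<in>carrier G. g [^]\<^bsub>G\<^esub> n = h) \<longrightarrow> (\<exists>h'\<in>H. h' [^]\<^bsub>G\<^esub> n = h))"

definition direct_summand :: "'a set \<Rightarrow> ('a, 'b) monoid_scheme \<Rightarrow> bool"
  where "direct_summand H G \<longleftrightarrow> subgroup H G \<and>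
    (\<exists>K. subgroup K G \<and> H \<inter> K = {\<one>\<^bsub>G\<^esub>} \<and> H <#>\<^bsub>G\<^esub> K = carrier G)"

definition separable_group :: "('a, 'b) monoid_scheme \<Rightarrow> bool"
  where "separable_group G \<longleftrightarrow> kappa_free aleph1 G \<and>
    (\<forall>H. pure_subgroup H G \<and> cyclic_group (G\<lparr>carrier := H\<rparr>) \<longrightarrow> direct_summand H G)"

end

theory Submission
  imports Defs
begin

text \<open>
  Let \<open>a \<noteq> 1\<close> generate a pure cyclic subgroup \<open>H\<close> of \<open>G\<close>. If some homomorphism \<open>\<phi> : G \<rightarrow> \<int>\<close>
  has \<open>\<phi> a = 1\<close>, its kernel is a complement of \<open>H\<close>, so \<open>H\<close> is a direct summand
  (\<open>direct_summand_of_hom\<close>). Such a \<open>\<phi>\<close> is forced to exist by finite approximations.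

  A condition is a finite partial function \<open>p\<close> from \<open>G\<close> to \<open>\<int>\<close> that is \<^emph>\<open>locally extendable\<close>: on
  every subgroup of size at most \<open>\<aleph>\<^sub>1\<close> containing its domain, some homomorphism to \<open>\<int>\<close> extends it.
  More common conditions are homomorphisms defined on finitely generated pure subgroups. Quantifying
  over the subgroups of size \<open>\<aleph>\<^sub>1\<close> instead dispenses with pure closures, because of a reflection
  property (\<open>common_obstruction\<close>): if each of \<open>\<aleph>\<^sub>1\<close> many partial functions fails to be locally
  extendable, then the subgroup generated by \<open>\<aleph>\<^sub>1\<close> many witnesses still has size at most \<open>\<aleph>\<^sub>1\<close>, and
  all of the functions fail on that one subgroup. This settles both requirements on the poset.

  \<^item> Density (\<open>locally_extendable_insert\<close>): if no value \<open>n \<in> \<int>\<close> at \<open>g\<close> could be added to \<open>p\<close>, a single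
    subgroup would refute all values at once; but \<open>p\<close> extends to a homomorphism there, which has
    some value at \<open>g\<close>.

  \<^item> Chain condition (\<open>uncountable_locally_extendable\<close>): given \<open>\<aleph>\<^sub>1\<close> conditions whose pairwise unions all
    fail, one subgroup \<open>H\<close> of size \<open>\<aleph>\<^sub>1\<close> refutes all these unions, and \<open>H\<close> is free because \<open>G\<close> is
    \<open>\<aleph>\<^sub>2\<close>-free. Extensions of the conditions to \<open>H\<close> matter only on finitely many basis elements each,
    and among uncountably many finite partial functions into \<open>\<int>\<close> two are compatible
    (\<open>uncountable_finite_partial_functions_compatible\<close>). The values of these two on the basis combine to a
    homomorphism on \<open>H\<close> extending both conditions (\<open>free_abelian_ccc\<close>), a contradiction.

  Martin's axiom for the \<open>|G| < 2\<^sup>\<aleph>\<^sup>0\<close> dense sets of conditions defined at a given element therefore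
  extends every locally extendable finite partial function to a homomorphism on \<open>G\<close>
  (\<open>martins_axiom_hom_extends\<close>). Finally, \<open>a \<mapsto> 1\<close> is locally extendable: in a free abelian group, an
  element that is a proper power of no element is sent to \<open>1\<close> by some homomorphism to \<open>\<int>\<close>
  (\<open>free_abelian_unimodular\<close>), and purity excludes proper roots of \<open>a\<close>.
\<close>

section \<open>Martin's axiom for posets of size at most the continuum\<close>

text \<open>The axiom speaks of posets of sets of natural numbers. An injection of the carrier into that
  type transports a poset of any other type, together with its dense sets, and pulls the generic
  filter back.\<close>

lemma martins_axiom_poset:
  assumes MA: "martins_axiom"
    and ne: "P \<noteq> {}" and po: "partial_order_on P r" and ccc: "ccc P r"
    and size: "|P| \<le>o continuum"
    and few: "|\<D>| <o continuum" and dense: "\<And>D. D \<in> \<D> \<Longrightarrow> poset_dense P r D"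
  shows "\<exists>F. poset_filter P r F \<and> (\<forall>D\<in>\<D>. F \<inter> D \<noteq> {})"
proof -
  obtain f :: "'a \<Rightarrow> nat set" where inj: "inj_on f P"
    using size card_of_ordLeq[of P "UNIV :: nat set set"] by blast
  have rP: "r \<subseteq> P \<times> P" and rrefl: "refl_on P r" and rtrans: "trans r" and ras: "antisym r"
    using partial_order_onD[OF po] by auto
  define r' where "r' = map_prod f f ` r"
  have r'_iff: "(f p, f q) \<in> r' \<longleftrightarrow> (p, q) \<in> r" if "p \<in> P" "q \<in> P" for p q
  proof
    assume "(f p, f q) \<in> r'"
    then obtain u v where uv: "(u, v) \<in> r" "f p = f u" "f q = f v"
      by (auto simp: r'_def)
    then have "u \<in> P" "v \<in> P"
      using rP by auto
    then have "p = u" "q = v"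
      using uv that inj by (auto dest: inj_onD)
    with uv show "(p, q) \<in> r"
      by simp
  qed (force simp: r'_def)
  have r'_sub: "r' \<subseteq> f ` P \<times> f ` P"
    using rP by (auto simp: r'_def)
  have "partial_order_on (f ` P) r'"
    unfolding partial_order_on_def preorder_on_def
  proof (intro conjI)
    show "refl_on (f ` P) r'"
      using rrefl r'_iff unfolding refl_on_def by auto
    show "trans r'"
    proof (rule transI)
      fix x y z assume xy: "(x, y) \<in> r'" and yz: "(y, z) \<in> r'"
      then obtain p q s where pqs: "p \<in> P" "q \<in> P" "s \<in> P" "x = f p" "y = f q" "z = f s"
        using r'_sub by blast
      with xy yz show "(x, z) \<in> r'"
        using r'_iff rtrans by (metis transD)
    qed
    show "antisym r'"
    proof (rule antisymI)
      fix x y assume xy: "(x, y) \<in> r'" "(y, x) \<in> r'"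
      then obtain p q where "p \<in> P" "q \<in> P" "x = f p" "y = f q"
        using r'_sub by blast
      with xy show "x = y"
        using r'_iff ras by (metis antisymD)
    qed
  qed (use r'_sub in auto)
  moreover have "ccc (f ` P) r'"
    unfolding ccc_def
  proof (intro allI impI)
    fix A assume A: "poset_antichain (f ` P) r' A"
    define B where "B = {p \<in> P. f p \<in> A}"
    have "poset_antichain P r B"
      unfolding poset_antichain_def
    proof (intro conjI ballI impI)
      fix p q assume pq: "p \<in> B" "q \<in> B" "p \<noteq> q"
      then have "f p \<noteq> f q" "f p \<in> A" "f q \<in> A" "p \<in> P" "q \<in> P"
        using inj by (auto simp: B_def inj_on_def)
      then have "\<not> poset_compatible (f ` P) r' (f p) (f q)"
        using A unfolding poset_antichain_def by blast
      then show "\<not> poset_compatible P r p q"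
        using r'_iff \<open>p \<in> P\<close> \<open>q \<in> P\<close> unfolding poset_compatible_def by blast
    qed (auto simp: B_def)
    then have "countable B"
      using ccc by (auto simp: ccc_def)
    moreover have "A = f ` B"
      using A by (auto simp: poset_antichain_def B_def)
    ultimately show "countable A"
      by simp
  qed
  moreover have "|(`) f ` \<D>| <o continuum"
    using card_of_image few ordLeq_ordLess_trans by blast
  moreover have "\<forall>D\<in>(`) f ` \<D>. poset_dense (f ` P) r' D"
  proof
    fix E assume "E \<in> (`) f ` \<D>"
    then obtain D where D: "D \<in> \<D>" and E: "E = f ` D"
      by auto
    have "\<exists>q\<in>E. (q, x) \<in> r'" if x: "x \<in> f ` P" for x
    proof -
      obtain p where p: "p \<in> P" "x = f p"
        using x by auto
      obtain q where "q \<in> D" "(q, p) \<in> r"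
        using dense[OF D] p by (auto simp: poset_dense_def)
      then show ?thesis
        using p rP r'_iff[of q p] E by blast
    qed
    then show "poset_dense (f ` P) r' E"
      using dense[OF D] E by (auto simp: poset_dense_def)
  qed
  ultimately obtain F where F: "poset_filter (f ` P) r' F" and meets: "\<forall>D\<in>(`) f ` \<D>. F \<inter> D \<noteq> {}"
    using MA ne unfolding martins_axiom_def by (metis image_is_empty)
  define F0 where "F0 = {p \<in> P. f p \<in> F}"
  have F_eq: "F = f ` F0"
    using F by (auto simp: F0_def poset_filter_def)
  have "poset_filter P r F0"
    unfolding poset_filter_def
  proof (intro conjI ballI impI)
    show "F0 \<noteq> {}"
      using F F_eq by (auto simp: poset_filter_def)
    show "q \<in> F0" if "p \<in> F0" "q \<in> P" "(p, q) \<in> r" for p q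
    proof -
      have "(f p, f q) \<in> r'" "f p \<in> F" "f q \<in> f ` P"
        using that r'_iff by (auto simp: F0_def)
      then have "f q \<in> F"
        using F unfolding poset_filter_def by blast
      then show ?thesis
        using that by (simp add: F0_def)
    qed
    show "\<exists>s\<in>F0. (s, p) \<in> r \<and> (s, q) \<in> r" if "p \<in> F0" "q \<in> F0" for p q
    proof -
      have pq: "f p \<in> F" "f q \<in> F" "p \<in> P" "q \<in> P"
        using that by (auto simp: F0_def)
      have "\<forall>x\<in>F. \<forall>y\<in>F. \<exists>z\<in>F. (z, x) \<in> r' \<and> (z, y) \<in> r'"
        using F by (simp add: poset_filter_def)
      then obtain z where z: "z \<in> F" "(z, f p) \<in> r'" "(z, f q) \<in> r'"
        using pq by meson
      then obtain s where s: "s \<in> F0" "z = f s"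
        using F_eq by blast
      then have "s \<in> P"
        by (simp add: F0_def)
      then show ?thesis
        using s z r'_iff pq by blast
    qed
  qed (auto simp: F0_def)
  moreover have "F0 \<inter> D \<noteq> {}" if "D \<in> \<D>" for D
  proof -
    have "D \<subseteq> P"
      using dense[OF that] by (simp add: poset_dense_def)
    moreover have "F \<inter> f ` D \<noteq> {}"
      using meets that by blast
    ultimately show ?thesis
      by (auto simp: F0_def)
  qed
  ultimately show ?thesis
    by blast
qed

section \<open>Cardinal arithmetic\<close>

lemma Card_order_aleph1: "Card_order aleph1"
  by (simp add: cardSuc_Card_order natLeq_Card_order)

lemma infinite_Field_aleph1: "infinite (Field aleph1)"
  using cardSuc_finite[OF natLeq_Card_order] by (simp add: Field_natLeq)

lemma ordLess_aleph1_iff: "|A| <o aleph1 \<longleftrightarrow> countable A"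
proof -
  have "|A| <o aleph1 \<longleftrightarrow> |A| \<le>o natLeq"
    by (simp add: cardSuc_ordLeq_ordLess natLeq_Card_order)
  also have "\<dots> \<longleftrightarrow> |A| \<le>o |UNIV :: nat set|"
    using card_of_nat ordIso_symmetric ordLeq_ordIso_trans by blast
  also have "\<dots> \<longleftrightarrow> countable A"
    by (simp add: countable_def flip: card_of_ordLeq)
  finally show ?thesis .
qed

lemma ordLess_aleph2_iff: "|A| <o aleph2 \<longleftrightarrow> |A| \<le>o aleph1"
  by (simp add: cardSuc_ordLeq_ordLess Card_order_aleph1)

lemma countable_ordLeq_aleph1: "countable A \<Longrightarrow> |A| \<le>o aleph1"
  using ordLess_aleph1_iff ordLess_imp_ordLeq by blast

lemma uncountable_subset_of_size_aleph1:
  assumes "uncountable A"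
  obtains B where "B \<subseteq> A" "uncountable B" "|B| \<le>o aleph1"
proof -
  have "aleph1 \<le>o |A|"
    using assms ordLess_aleph1_iff[of A] Card_order_aleph1 
    by (simp add: card_order_on_well_order_on not_ordLess_iff_ordLeq)
  moreover have "|Field aleph1| =o aleph1"
    by (simp add: card_of_Field_ordIso Card_order_aleph1)
  ultimately obtain f where f: "inj_on f (Field aleph1)" "f ` Field aleph1 \<subseteq> A"
    by (metis card_of_ordLeq ordIso_ordLeq_trans)
  have iso: "|f ` Field aleph1| =o aleph1"
    using f(1) \<open>|Field aleph1| =o aleph1\<close>
    by (meson bij_betw_imageI card_of_ordIsoI ordIso_symmetric ordIso_transitive)
  then have "uncountable (f ` Field aleph1)"
    using ordLess_aleph1_iff not_ordLess_ordIso by blast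
  with iso show ?thesis
    using that f(2) ordIso_imp_ordLeq by blast
qed

lemma card_of_Fpow_Times_int_ordLeq_continuum:
  assumes "|A| <o continuum"
  shows "|Fpow (A \<times> (UNIV :: int set))| \<le>o continuum"
proof -
  have inf: "infinite (UNIV :: nat set set)"
    by (simp add: Finite_Set.finite_set)
  show ?thesis
  proof (cases "finite (A \<times> (UNIV :: int set))")
    case True
    then have "finite (Fpow (A \<times> (UNIV :: int set)))"
      by (simp add: Fpow_def)
    with inf show ?thesis
      using finite_ordLess_infinite2 ordLess_imp_ordLeq by blast
  next
    case False
    have "|UNIV :: int set| \<le>o continuum"
      using infinite_iff_card_of_countable[of "UNIV :: int set" "UNIV :: nat set set"] inf infinite_UNIV_int by auto
    then have "|A \<times> (UNIV :: int set)| \<le>o continuum"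
      using assms ordLess_imp_ordLeq[of "|A|" continuum] inf
      by (intro card_of_Times_ordLeq_infinite_Field) (auto simp: card_of_Card_order)
    then show ?thesis
      using card_of_Fpow_infinite[OF False] ordIso_ordLeq_trans by blast
  qed
qed

section \<open>Uncountably many finite partial functions\<close>

lemma uncountable_fibre:
  fixes g :: "'i \<Rightarrow> 'v :: countable"
  assumes "uncountable I"
  obtains v where "uncountable {i \<in> I. g i = v}"
proof -
  have "I = (\<Union>v. {i \<in> I. g i = v})"
    by auto
  then show ?thesis
    using that assms by (metis (lifting) countable_UN countableI_type)
qed

text \<open>The chain condition for finite partial functions into a countable set; \<open>f i\<close> is considered on the
  finite domain \<open>D i\<close> only. The family is indexed so that equal functions with different
  indices count as a compatible pair. Induction on the common size of the domains replaces
  the \<open>\<Delta>\<close>-system lemma: a point lying in uncountably many domains can be removed after fixing the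
  value there, and if every point lies in only countably many domains, then some two domains are
  disjoint.\<close>

lemma uncountable_finite_partial_functions_compatible:
  fixes f :: "'i \<Rightarrow> 's \<Rightarrow> 'v :: countable"
  assumes "uncountable I" "\<And>i. i \<in> I \<Longrightarrow> finite (D i)"
  shows "\<exists>i\<in>I. \<exists>j\<in>I. i \<noteq> j \<and> (\<forall>x\<in>D i \<inter> D j. f i x = f j x)"
proof -
  have equal_size: "\<exists>i\<in>I. \<exists>j\<in>I. i \<noteq> j \<and> (\<forall>x\<in>D i \<inter> D j. f i x = f j x)"
    if "uncountable I" "\<And>i. i \<in> I \<Longrightarrow> finite (D i) \<and> card (D i) = n" for n I and D :: "'i \<Rightarrow> 's set"
    using that
  proof (induction n arbitrary: I D)
    case 0
    then obtain i j where "i \<in> I" "j \<in> I" "i \<noteq> j"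
      by (metis (mono_tags, opaque_lifting) countable_subset from_nat_into
          range_eqI subsetI uncountable_def)
    then show ?case
      using "0.prems"(2)[of i] by (metis Int_iff card_0_eq empty_iff)
  next
    case (Suc n)
    show ?case
    proof (cases "\<exists>x. uncountable {i \<in> I. x \<in> D i}")
      case True
      then obtain x where x: "uncountable {i \<in> I. x \<in> D i}"
        by blast
      \<comment> \<open>The remaining functions all agree at \<open>x\<close>, so compatibility off \<open>x\<close> suffices.\<close>
      obtain v where "uncountable {i \<in> {i \<in> I. x \<in> D i}. f i x = v}"
        using uncountable_fibre[OF x, of "\<lambda>i. f i x"] by blast
      from Suc.IH[OF this, of "\<lambda>i. D i - {x}"] Suc.prems(2) show ?thesis
        by fastforce
    next
      case False
      obtain i where i: "i \<in> I"
        using Suc.prems(1) by (metis countable_empty ex_in_conv)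
      have "countable (insert i (\<Union>x\<in>D i. {j \<in> I. x \<in> D j}))"
        using False Suc.prems(2)[OF i] by (auto intro: countable_finite)
      then obtain j where "j \<in> I" "j \<notin> insert i (\<Union>x\<in>D i. {j \<in> I. x \<in> D j})"
        using Suc.prems(1) by (meson countable_subset subsetI)
      then show ?thesis
        using i by blast
    qed
  qed
  obtain n where "uncountable {i \<in> I. card (D i) = n}"
    using uncountable_fibre[OF assms(1), of "\<lambda>i. card (D i)"] by blast
  from equal_size[OF this, of D n] show ?thesis
    using assms(2) by auto
qed

section \<open>Homomorphisms from free abelian groups to the integers\<close>

definition hom_extends :: "('a, 'b) monoid_scheme \<Rightarrow> ('a \<times> int) set \<Rightarrow> bool"
  where "hom_extends H p \<longleftrightarrow> (\<exists>\<phi>\<in>hom H integer_group. \<forall>(x, n)\<in>p. \<phi> x = n)"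

lemma hom_free_Abelian_group_cong:
  assumes "\<phi> \<in> hom (free_Abelian_group S) integer_group" "\<psi> \<in> hom (free_Abelian_group S) integer_group"
    and c: "Poly_Mapping.keys c \<subseteq> S"
    and eq: "\<And>s. s \<in> Poly_Mapping.keys c \<Longrightarrow> \<phi> (frag_of s) = \<psi> (frag_of s)"
  shows "\<phi> c = \<psi> c"
proof -
  interpret \<phi>: group_hom "free_Abelian_group S" integer_group \<phi>
    using assms(1) by (simp add: group_hom_def group_hom_axioms_def)
  interpret \<psi>: group_hom "free_Abelian_group S" integer_group \<psi>
    using assms(2) by (simp add: group_hom_def group_hom_axioms_def)
  have diff: "\<theta> (x - y) = \<theta> x - \<theta> y"
    if "\<theta> \<in> hom (free_Abelian_group S) integer_group" "Poly_Mapping.keys x \<subseteq> S" "Poly_Mapping.keys y \<subseteq> S"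
    for \<theta> x y
  proof -
    have "Poly_Mapping.keys (x - y) \<subseteq> S"
      using keys_diff[of x y] that by blast
    then have "\<theta> ((x - y) + y) = \<theta> (x - y) + \<theta> y"
      using hom_mult[OF that(1), of "x - y" y] that by simp
    then show ?thesis
      by simp
  qed
  show ?thesis
  proof (rule free_Abelian_group_induct[of c "Poly_Mapping.keys c"])
    show "\<phi> 0 = \<psi> 0"
      using \<phi>.hom_one \<psi>.hom_one by simp
    show "\<phi> (x - y) = \<psi> (x - y)"
      if "Poly_Mapping.keys x \<subseteq> Poly_Mapping.keys c" "Poly_Mapping.keys y \<subseteq> Poly_Mapping.keys c"
        "\<phi> x = \<psi> x" "\<phi> y = \<psi> y" for x y
      using that c diff assms(1,2) by (metis order_trans)
  qed (use eq in auto)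
qed

text \<open>Extensions \<open>\<phi> p\<close> of the partial functions \<open>p\<close> to \<open>H\<close> are chosen first. Their values on \<open>p\<close> depend
  only on the finite set \<open>D p\<close> of basis elements that occur in the domain of \<open>p\<close>, so two extensions
  that agree on \<open>D p \<inter> D q\<close> can be merged by prescribing values on the basis.\<close>

lemma free_abelian_ccc:
  assumes gH: "group H" and H: "is_free_abelian H" and A: "uncountable A"
    and fin: "\<And>p. p \<in> A \<Longrightarrow> finite p \<and> Domain p \<subseteq> carrier H \<and> hom_extends H p"
  shows "\<exists>p\<in>A. \<exists>q\<in>A. p \<noteq> q \<and> hom_extends H (p \<union> q)"
proof -
  obtain S :: "'a set" and h where h: "h \<in> iso H (free_Abelian_group S)"
    using H by (auto simp: is_free_abelian_def is_iso_def)
  have h_hom: "h \<in> hom H (free_Abelian_group S)" and bij: "bij_betw h (carrier H) (carrier (free_Abelian_group S))"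
    using h by (auto simp: iso_def)
  obtain \<phi> where \<phi>: "\<And>p. p \<in> A \<Longrightarrow> \<phi> p \<in> hom H integer_group \<and> (\<forall>(x, n)\<in>p. \<phi> p x = n)"
    using fin unfolding hom_extends_def by metis
  have h_closed: "h x \<in> carrier (free_Abelian_group S)" if "x \<in> carrier H" for x
    using h_hom that by (rule hom_in_carrier)
  have k_hom: "inv_into (carrier H) h \<in> hom (free_Abelian_group S) H"
    using group.iso_set_sym[OF gH h] by (simp add: iso_def)
  define k where "k = inv_into (carrier H) h"
  have k_h: "k (h x) = x" if "x \<in> carrier H" for x
    using that bij by (simp add: k_def bij_betw_def)
  have pk_hom: "\<phi> p \<circ> k \<in> hom (free_Abelian_group S) integer_group" if "p \<in> A" for p
    using hom_compose[OF k_hom, of "\<phi> p" integer_group] \<phi>[OF that] unfolding k_def by blast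
  define D where "D p = (\<Union>x\<in>Domain p. Poly_Mapping.keys (h x))" for p :: "('a \<times> int) set"
  have "finite (D p)" if "p \<in> A" for p
    using fin[OF that] by (simp add: D_def finite_Domain)
  then obtain p q where pq: "p \<in> A" "q \<in> A" "p \<noteq> q"
    and agree: "\<And>s. s \<in> D p \<inter> D q \<Longrightarrow> (\<phi> p \<circ> k) (frag_of s) = (\<phi> q \<circ> k) (frag_of s)"
    using uncountable_finite_partial_functions_compatible[OF A, of D "\<lambda>p s. (\<phi> p \<circ> k) (frag_of s)"]
    by blast
  obtain \<psi> where \<psi>: "\<psi> \<in> hom (free_Abelian_group S) integer_group"
    and \<psi>_basis: "\<And>s. s \<in> S \<Longrightarrow> \<psi> (frag_of s) = (if s \<in> D p then (\<phi> p \<circ> k) (frag_of s) else (\<phi> q \<circ> k) (frag_of s))"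
    using comm_group.free_Abelian_group_universal[OF abelian_integer_group, of "\<lambda>s. if s \<in> D p then (\<phi> p \<circ> k) (frag_of s) else (\<phi> q \<circ> k) (frag_of s)" S]
    by auto
  have agrees: "\<psi> (h x) = n" if "t \<in> {p, q}" "(x, n) \<in> t" for t x n
  proof -
    have t: "t \<in> A" "x \<in> Domain t"
      using that pq by auto
    then have x: "x \<in> carrier H" and keys: "Poly_Mapping.keys (h x) \<subseteq> S"
      using fin[of t] h_closed[of x] by auto
    have "\<psi> (h x) = (\<phi> t \<circ> k) (h x)"
    proof (rule hom_free_Abelian_group_cong[OF \<psi> pk_hom keys])
      fix s assume s: "s \<in> Poly_Mapping.keys (h x)"
      then have "s \<in> D t"
        using t by (auto simp: D_def)
      then show "\<psi> (frag_of s) = (\<phi> t \<circ> k) (frag_of s)"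
        using s keys \<psi>_basis[of s] agree[of s] that(1) by auto
    qed (rule t)
    also have "\<dots> = n"
      using k_h[OF x] \<phi>[OF t(1)] that(2) by auto
    finally show ?thesis .
  qed
  have "\<psi> \<circ> h \<in> hom H integer_group"
    by (rule hom_compose[OF h_hom \<psi>])
  then have "hom_extends H (p \<union> q)"
    unfolding hom_extends_def using agrees by (intro bexI[of _ "\<psi> \<circ> h"]) auto
  with pq show ?thesis
    by blast
qed

lemma free_abelian_hom_nonzero:
  assumes gH: "group H" and free: "is_free_abelian H" and a: "a \<in> carrier H" "a \<noteq> \<one>\<^bsub>H\<^esub>"
  obtains \<phi> where "\<phi> \<in> hom H integer_group" "\<phi> a \<noteq> 0"
proof -
  obtain S :: "'a set" and h where h: "h \<in> iso H (free_Abelian_group S)"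
    using free by (auto simp: is_free_abelian_def is_iso_def)
  have h_hom: "h \<in> hom H (free_Abelian_group S)" and inj: "inj_on h (carrier H)"
    using h by (auto simp: iso_def bij_betw_def)
  have "h \<one>\<^bsub>H\<^esub> = 0"
    using hom_one[OF h_hom gH] by simp
  then have "h a \<noteq> 0"
    using inj a group.is_monoid[OF gH] by (metis inj_onD monoid.one_closed)
  then obtain s where s: "Poly_Mapping.lookup (h a) s \<noteq> 0"
    by (metis lookup_zero poly_mapping_eqI)
  have "(\<lambda>c. Poly_Mapping.lookup c s) \<in> hom (free_Abelian_group S) integer_group"
    by (auto simp: hom_def lookup_add)
  from hom_compose[OF h_hom this] show ?thesis
    by (rule that) (use s in simp)
qed

text \<open>The values at \<open>a\<close> of all homomorphisms to \<open>\<int>\<close> form an ideal, generated by its least positive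
  element \<open>d\<close>. The coordinates of \<open>a\<close> are among these values, so \<open>a\<close> is a \<open>d\<close>-th power, whence
  \<open>d = 1\<close>.\<close>

lemma free_abelian_unimodular:
  assumes gH: "group H" and free: "is_free_abelian H" and a: "a \<in> carrier H"
    and root: "\<And>b n. b \<in> carrier H \<Longrightarrow> b [^]\<^bsub>H\<^esub> (n :: nat) = a \<Longrightarrow> n = 1"
  shows "\<exists>\<phi>\<in>hom H integer_group. \<phi> a = 1"
proof -
  obtain S :: "'a set" and h where h: "h \<in> iso H (free_Abelian_group S)"
    using free by (auto simp: is_free_abelian_def is_iso_def)
  have h_hom: "h \<in> hom H (free_Abelian_group S)" and bij: "bij_betw h (carrier H) (carrier (free_Abelian_group S))"
    using h by (auto simp: iso_def)
  interpret h: group_hom H "free_Abelian_group S" h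
    using gH h_hom by (simp add: group_hom_def group_hom_axioms_def)
  define I where "I = {\<phi> a | \<phi>. \<phi> \<in> hom H integer_group}"
  have comb: "x - m * y \<in> I" if xy: "x \<in> I" "y \<in> I" for x y m
  proof -
    obtain \<phi> \<psi> where "\<phi> \<in> hom H integer_group" "\<psi> \<in> hom H integer_group" "x = \<phi> a" "y = \<psi> a"
      using xy unfolding I_def by blast
    then have "(\<lambda>z. \<phi> z - m * \<psi> z) \<in> hom H integer_group" "x - m * y = \<phi> a - m * \<psi> a"
      by (auto simp: hom_def algebra_simps)
    then show ?thesis
      unfolding I_def by (intro CollectI exI[of _ "\<lambda>z. \<phi> z - m * \<psi> z"]) simp
  qed
  have "a \<noteq> \<one>\<^bsub>H\<^esub>"
  proof
    assume "a = \<one>\<^bsub>H\<^esub>"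
    then have "(2 :: nat) = 1"
      using root[of "\<one>\<^bsub>H\<^esub>" 2] by simp
    then show False
      by simp
  qed
  then obtain e where e: "e \<in> I" "e \<noteq> 0"
    using free_abelian_hom_nonzero[OF gH free a] unfolding I_def by blast
  have "- e \<in> I"
    using comb[OF e(1) e(1), of 2] by simp
  then have "\<bar>e\<bar> \<in> I"
    using e(1) by (simp add: abs_if)
  then have "\<exists>n. 0 < n \<and> int n \<in> I"
    using e(2) by (intro exI[of _ "nat \<bar>e\<bar>"]) simp
  then obtain d where d: "0 < d" "int d \<in> I" and least: "\<And>n. 0 < n \<Longrightarrow> int n \<in> I \<Longrightarrow> d \<le> n"
    using exists_least_iff[of "\<lambda>n. 0 < n \<and> int n \<in> I"] not_less by blast
  have dvd: "int d dvd x" if "x \<in> I" for x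
  proof (rule ccontr)
    assume "\<not> int d dvd x"
    then have "x mod int d \<noteq> 0"
      by (simp add: dvd_eq_mod_eq_0)
    moreover have "0 \<le> x mod int d" "x mod int d < int d"
      using d(1) by simp_all
    moreover have "x mod int d \<in> I"
      using comb[OF that d(2), of "x div int d"] by (simp add: minus_div_mult_eq_mod)
    ultimately show False
      using least[of "nat (x mod int d)"] by simp
  qed
  define c where "c = Poly_Mapping.map (\<lambda>x. x div int d) (h a)"
  have lookup_c: "int d * Poly_Mapping.lookup c s = Poly_Mapping.lookup (h a) s" for s
  proof -
    have "(\<lambda>c. Poly_Mapping.lookup c s) \<in> hom (free_Abelian_group S) integer_group"
      by (auto simp: hom_def lookup_add)
    from hom_compose[OF h_hom this] have "Poly_Mapping.lookup (h a) s \<in> I"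
      unfolding I_def by (intro CollectI exI[of _ "(\<lambda>c. Poly_Mapping.lookup c s) \<circ> h"]) simp
    then show ?thesis
      using dvd by (simp add: c_def map.rep_eq when_def)
  qed
  have "frag_cmul (int d) c = h a"
    by (intro poly_mapping_eqI) (simp add: lookup_c)
  moreover have "Poly_Mapping.keys c \<subseteq> S"
  proof -
    have "s \<in> Poly_Mapping.keys (h a)" if "s \<in> Poly_Mapping.keys c" for s
      using that d(1) lookup_c[of s, symmetric] by (simp add: in_keys_iff)
    then show ?thesis
      using h.hom_closed[OF a] by auto
  qed
  then obtain b where b: "b \<in> carrier H" "h b = c"
    using bij unfolding bij_betw_def by (metis carrier_free_Abelian_group_iff imageE)
  ultimately have "h (b [^]\<^bsub>H\<^esub> d) = h a"
    by (simp add: h.hom_nat_pow)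
  then have "b [^]\<^bsub>H\<^esub> d = a"
    using bij b a h.G.nat_pow_closed[OF b(1)] unfolding bij_betw_def by (auto dest: inj_onD)
  then have "d = 1"
    using root b by blast
  then show ?thesis
    using d(2) unfolding I_def by auto
qed


section \<open>Finite partial functions that extend locally\<close>

context comm_group
begin

lemma group_subgroup: "subgroup K G \<Longrightarrow> group (G\<lparr>carrier := K\<rparr>)"
  using subgroup.subgroup_is_group is_group by blast

text \<open>The subgroup is the image of a free abelian group on \<open>X\<close>. Countably many further generators,
  sent to \<open>\<one>\<close>, make the basis infinite, so that the free group is no larger than its basis.\<close>

lemma subgroup_of_bounded_size:
  assumes r: "Card_order r" "infinite (Field r)" and X: "X \<subseteq> carrier G" "|X| \<le>o r"
  obtains K where "subgroup K G" "X \<subseteq> K" "|K| \<le>o r"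
proof -
  define S where "S = Inl ` X \<union> range (Inr :: nat \<Rightarrow> 'a + nat)"
  have inf: "infinite S"
    by (auto simp: S_def range_inj_infinite)
  have "|UNIV :: nat set| \<le>o r"
    using r by (meson card_of_Field_ordIso infinite_iff_card_of_nat ordLeq_ordIso_trans)
  then have "|X <+> (UNIV :: nat set)| \<le>o r"
    using r X by (intro card_of_Plus_ordLeq_infinite_Field)
  then have S: "|S| \<le>o r"
    by (simp add: S_def Plus_def)
  define f where "f = (\<lambda>s :: 'a + nat. case s of Inl x \<Rightarrow> x | Inr _ \<Rightarrow> \<one>)"
  have "f ` S \<subseteq> carrier G"
    using X by (auto simp: f_def S_def)
  then obtain h where h: "h \<in> hom (free_Abelian_group S) G" "\<And>x. x \<in> S \<Longrightarrow> h (frag_of x) = f x"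
    using free_Abelian_group_universal by metis
  interpret h: group_hom "free_Abelian_group S" G h
    using h(1) by (simp add: group_hom_def group_hom_axioms_def is_group)
  define K where "K = h ` carrier (free_Abelian_group S)"
  have "subgroup K G"
    unfolding K_def by (rule h.img_is_subgroup)
  moreover have "X \<subseteq> K"
  proof
    fix x assume "x \<in> X"
    then have "Inl x \<in> S"
      by (simp add: S_def)
    then have "x = h (frag_of (Inl x))" "frag_of (Inl x) \<in> carrier (free_Abelian_group S)"
      using h(2)[of "Inl x"] by (auto simp: f_def)
    then show "x \<in> K"
      unfolding K_def by (rule image_eqI)
  qed
  moreover have "|K| \<le>o r"
  proof -
    have "|carrier (free_Abelian_group S)| =o |S|"
      using eqpoll_free_Abelian_group_infinite[OF inf] by (simp add: eqpoll_iff_card_of_ordIso)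
    then show ?thesis
      unfolding K_def using S card_of_image ordIso_ordLeq_trans ordLeq_transitive by blast
  qed
  ultimately show ?thesis
    by (rule that)
qed

lemmas subgroup_of_size_aleph1 = subgroup_of_bounded_size[OF Card_order_aleph1 infinite_Field_aleph1]

end

lemma hom_extends_mono:
  assumes "hom_extends (G\<lparr>carrier := K\<rparr>) p" "L \<subseteq> K" "q \<subseteq> p"
  shows "hom_extends (G\<lparr>carrier := L\<rparr>) q"
proof -
  obtain \<phi> where \<phi>: "\<phi> \<in> hom (G\<lparr>carrier := K\<rparr>) integer_group" "\<forall>(x, n)\<in>p. \<phi> x = n"
    using assms(1) unfolding hom_extends_def by blast
  have "\<phi> \<in> hom (G\<lparr>carrier := L\<rparr>) integer_group"
    using \<phi>(1) assms(2) by (simp add: hom_def subset_eq)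
  moreover have "\<forall>(x, n)\<in>q. \<phi> x = n"
    using \<phi>(2) assms(3) by auto
  ultimately show ?thesis
    unfolding hom_extends_def by blast
qed

text \<open>The bound \<open>\<aleph>\<^sub>1\<close> is the largest for which all the subgroups concerned are free in an \<open>\<aleph>\<^sub>2\<close>-free
  group, and it allows \<open>\<aleph>\<^sub>1\<close> of them to be collected into one.\<close>

definition locally_extendable :: "('a, 'b) monoid_scheme \<Rightarrow> ('a \<times> int) set \<Rightarrow> bool"
  where "locally_extendable G p \<longleftrightarrow> (\<forall>K. subgroup K G \<and> |K| \<le>o aleph1 \<and> Domain p \<subseteq> K \<longrightarrow>
    hom_extends (G\<lparr>carrier := K\<rparr>) p)"

context comm_group
begin

text \<open>The subgroup generated by one witness of failure for each member of \<open>Q\<close> refutes all of \<open>Q\<close>,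
  since an extension to it would restrict to an extension to each witness.\<close>

lemma common_obstruction:
  assumes Q: "|Q| \<le>o aleph1"
    and bad: "\<And>q. q \<in> Q \<Longrightarrow> \<not> locally_extendable G q"
  obtains H where "subgroup H G" "|H| \<le>o aleph1"
    "\<And>q. q \<in> Q \<Longrightarrow> Domain q \<subseteq> H \<and> \<not> hom_extends (G\<lparr>carrier := H\<rparr>) q"
proof -
  obtain K where K: "\<And>q. q \<in> Q \<Longrightarrow> subgroup (K q) G \<and> |K q| \<le>o aleph1 \<and> Domain q \<subseteq> K q \<and>
      \<not> hom_extends (G\<lparr>carrier := K q\<rparr>) q"
    using bad unfolding locally_extendable_def by metis
  have "|\<Union>q\<in>Q. K q| \<le>o aleph1"
    using K Q by (intro card_of_UNION_ordLeq_infinite_Field Card_order_aleph1 infinite_Field_aleph1) auto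
  moreover have "(\<Union>q\<in>Q. K q) \<subseteq> carrier G"
    using K subgroup.subset by blast
  ultimately obtain H where H: "subgroup H G" "|H| \<le>o aleph1" "(\<Union>q\<in>Q. K q) \<subseteq> H"
    using subgroup_of_size_aleph1 by metis
  have "Domain q \<subseteq> H \<and> \<not> hom_extends (G\<lparr>carrier := H\<rparr>) q" if "q \<in> Q" for q
  proof -
    have "K q \<subseteq> H"
      using that H(3) by blast
    then show ?thesis
      using K[OF that] hom_extends_mono by blast
  qed
  with H show ?thesis
    using that by blast
qed

text \<open>Density. The candidate values are countably many, so if all failed, one subgroup would refute
  all of them, including the value at \<open>g\<close> of an extension of \<open>p\<close> to that very subgroup.\<close>

lemma locally_extendable_insert:
  assumes p: "locally_extendable G p" and g: "g \<in> carrier G"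
  shows "\<exists>n. locally_extendable G (insert (g, n) p)"
proof (rule ccontr)
  assume "\<not> ?thesis"
  then have bad: "\<not> locally_extendable G q" if "q \<in> range (\<lambda>n. insert (g, n) p)" for q
    using that by auto
  have "|range (\<lambda>n :: int. insert (g, n) p)| \<le>o aleph1"
    by (intro countable_ordLeq_aleph1) simp
  from common_obstruction[OF this bad] obtain H where H: "subgroup H G" "|H| \<le>o aleph1"
    and obstructs: "\<And>q. q \<in> range (\<lambda>n. insert (g, n) p) \<Longrightarrow>
      Domain q \<subseteq> H \<and> \<not> hom_extends (G\<lparr>carrier := H\<rparr>) q"
    by metis
  have no: "Domain (insert (g, n) p) \<subseteq> H \<and> \<not> hom_extends (G\<lparr>carrier := H\<rparr>) (insert (g, n) p)" for n
    by (rule obstructs) simp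
  have "hom_extends (G\<lparr>carrier := H\<rparr>) p"
    using p H no[of 0] unfolding locally_extendable_def by auto
  then obtain \<phi> where "\<phi> \<in> hom (G\<lparr>carrier := H\<rparr>) integer_group" "\<forall>(x, n)\<in>p. \<phi> x = n"
    unfolding hom_extends_def by blast
  then have "hom_extends (G\<lparr>carrier := H\<rparr>) (insert (g, \<phi> g) p)"
    unfolding hom_extends_def by (intro bexI[of _ \<phi>]) auto
  with no show False
    by blast
qed

text \<open>The chain condition. There are only \<open>\<aleph>\<^sub>1\<close> pairwise unions of \<open>\<aleph>\<^sub>1\<close> conditions, so one subgroup of size
  \<open>\<aleph>\<^sub>1\<close> would refute them all; but that subgroup is free, and \<open>free_abelian_ccc\<close> applies to it.\<close>

lemma uncountable_locally_extendable:
  assumes free: "kappa_free aleph2 G" and A: "uncountable A"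
    and ext: "\<And>p. p \<in> A \<Longrightarrow> finite p \<and> Domain p \<subseteq> carrier G \<and> locally_extendable G p"
  shows "\<exists>p\<in>A. \<exists>q\<in>A. p \<noteq> q \<and> locally_extendable G (p \<union> q)"
proof (rule ccontr)
  assume incompatible: "\<not> ?thesis"
  obtain B where B: "B \<subseteq> A" "uncountable B" "|B| \<le>o aleph1"
    using uncountable_subset_of_size_aleph1[OF A] .
  define Q where "Q = (\<lambda>(p, q). p \<union> q) ` {(p, q) \<in> B \<times> B. p \<noteq> q}"
  have "|B \<times> B| \<le>o aleph1"
    using B by (intro card_of_Times_ordLeq_infinite_Field Card_order_aleph1 infinite_Field_aleph1)
  moreover have "|Q| \<le>o |B \<times> B|"
    unfolding Q_def by (rule ordLeq_transitive[OF card_of_image card_of_mono1]) auto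
  ultimately have "|Q| \<le>o aleph1"
    using ordLeq_transitive by blast
  moreover have "\<not> locally_extendable G q" if "q \<in> Q" for q
    using that incompatible B unfolding Q_def by auto
  ultimately obtain H where H: "subgroup H G" "|H| \<le>o aleph1"
    and no: "\<And>q. q \<in> Q \<Longrightarrow> Domain q \<subseteq> H \<and> \<not> hom_extends (G\<lparr>carrier := H\<rparr>) q"
    using common_obstruction by metis
  have "finite p \<and> Domain p \<subseteq> carrier (G\<lparr>carrier := H\<rparr>) \<and> hom_extends (G\<lparr>carrier := H\<rparr>) p" if p: "p \<in> B" for p
  proof -
    obtain q where "q \<in> B" "p \<noteq> q"
      using B(2) by (metis countable_empty countable_insert subsetI countable_subset insertI1)
    then have "p \<union> q \<in> Q"
      using p by (auto simp: Q_def)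
    then have "Domain p \<subseteq> H"
      using no[of "p \<union> q"] by auto
    then show ?thesis
      using p B(1) ext[of p] H unfolding locally_extendable_def by auto
  qed
  moreover have "is_free_abelian (G\<lparr>carrier := H\<rparr>)"
    using free H unfolding kappa_free_def ordLess_aleph2_iff by blast
  ultimately obtain p q where "p \<in> B" "q \<in> B" "p \<noteq> q" "hom_extends (G\<lparr>carrier := H\<rparr>) (p \<union> q)"
    using free_abelian_ccc[OF group_subgroup[OF H(1)] _ B(2)] by meson
  moreover from this have "p \<union> q \<in> Q"
    by (auto simp: Q_def)
  ultimately show False
    using no by blast
qed

section \<open>The generic homomorphism\<close>

text \<open>Conditions are the locally extendable finite partial functions above \<open>p\<close>, larger functions being
  stronger. A filter meeting all the sets \<open>D g\<close> has a total function as its union. That function is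
  a homomorphism because its values at \<open>x\<close>, \<open>y\<close> and \<open>x \<otimes> y\<close> are already fixed by one condition, which
  a homomorphism extends on some subgroup.\<close>

theorem martins_axiom_hom_extends:
  assumes MA: "martins_axiom" and free: "kappa_free aleph2 G" and small: "|carrier G| <o continuum"
    and p: "finite p" "Domain p \<subseteq> carrier G" "locally_extendable G p"
  shows "hom_extends G p"
proof -
  define P where "P = {q. finite q \<and> Domain q \<subseteq> carrier G \<and> p \<subseteq> q \<and> locally_extendable G q}"
  define r where "r = {(q, s). q \<in> P \<and> s \<in> P \<and> s \<subseteq> q}"
  define D where "D g = {q \<in> P. g \<in> Domain q}" for g
  have "P \<noteq> {}"
    using p by (auto simp: P_def)
  moreover have "partial_order_on P r"
    unfolding partial_order_on_def preorder_on_def r_def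
    by (auto simp: refl_on_def trans_def antisym_def)
  moreover have "ccc P r"
    unfolding ccc_def
  proof (intro allI impI)
    fix A assume A: "poset_antichain P r A"
    then have AP: "A \<subseteq> P"
      by (simp add: poset_antichain_def)
    show "countable A"
    proof (rule ccontr)
      assume "uncountable A"
      from uncountable_locally_extendable[OF free this] AP
      obtain s t where st: "s \<in> A" "t \<in> A" "s \<noteq> t" "locally_extendable G (s \<union> t)"
        unfolding P_def by blast
      then have "s \<union> t \<in> P"
        using AP by (auto simp: P_def)
      then have "poset_compatible P r s t"
        using st AP unfolding poset_compatible_def by (intro bexI[of _ "s \<union> t"]) (auto simp: r_def)
      then show False
        using A st by (auto simp: poset_antichain_def)
    qed
  qed
  moreover have "|P| \<le>o continuum"
  proof -
    have "P \<subseteq> Fpow (carrier G \<times> UNIV)"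
      by (auto simp: P_def Fpow_def)
    then show ?thesis
      using card_of_Fpow_Times_int_ordLeq_continuum[OF small] card_of_mono1 ordLeq_transitive by blast
  qed
  moreover have "|D ` carrier G| <o continuum"
    using card_of_image small ordLeq_ordLess_trans by blast
  moreover have "poset_dense P r E" if E: "E \<in> D ` carrier G" for E
  proof -
    obtain g where g: "g \<in> carrier G" "E = D g"
      using E by auto
    have "\<exists>t\<in>D g. (t, s) \<in> r" if s: "s \<in> P" for s
    proof -
      obtain n where "locally_extendable G (insert (g, n) s)"
        using locally_extendable_insert[OF _ g(1)] s unfolding P_def by blast
      then have "insert (g, n) s \<in> P"
        using s g by (auto simp: P_def)
      then show ?thesis
        using s by (intro bexI[of _ "insert (g, n) s"]) (auto simp: r_def D_def)
    qed
    then show ?thesis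
      using g by (auto simp: poset_dense_def D_def)
  qed
  ultimately obtain F where F: "poset_filter P r F" and "\<forall>E\<in>D ` carrier G. F \<inter> E \<noteq> {}"
    using martins_axiom_poset[OF MA] by metis
  then have meets: "\<exists>q\<in>F. g \<in> Domain q" if "g \<in> carrier G" for g
    using that by (auto simp: D_def)
  have FP: "F \<subseteq> P" "F \<noteq> {}"
    using F by (auto simp: poset_filter_def)
  have directed: "\<exists>u\<in>F. s \<subseteq> u \<and> t \<subseteq> u" if st: "s \<in> F" "t \<in> F" for s t
  proof -
    have "\<forall>s\<in>F. \<forall>t\<in>F. \<exists>u\<in>F. (u, s) \<in> r \<and> (u, t) \<in> r"
      using F by (simp add: poset_filter_def)
    then obtain u where "u \<in> F" "(u, s) \<in> r" "(u, t) \<in> r"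
      using st by meson
    then show ?thesis
      by (auto simp: r_def)
  qed
  have hom_on: "\<exists>K \<psi>. subgroup K G \<and> Domain s \<subseteq> K \<and> \<psi> \<in> hom (G\<lparr>carrier := K\<rparr>) integer_group \<and>
      (\<forall>(x, n)\<in>s. \<psi> x = n)" if "s \<in> F" for s
  proof -
    have s: "finite s" "Domain s \<subseteq> carrier G" "locally_extendable G s"
      using that FP by (auto simp: P_def)
    have "|Domain s| \<le>o aleph1"
      using s(1) by (simp add: countable_ordLeq_aleph1 countable_finite finite_Domain)
    then obtain K where K: "subgroup K G" "Domain s \<subseteq> K" "|K| \<le>o aleph1"
      using subgroup_of_size_aleph1[OF s(2)] by blast
    then have "hom_extends (G\<lparr>carrier := K\<rparr>) s"
      using s(3) unfolding locally_extendable_def by blast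
    with K(1,2) show ?thesis
      unfolding hom_extends_def by blast
  qed
  have unique: "m = n" if mn: "(x, m) \<in> \<Union>F" "(x, n) \<in> \<Union>F" for x m n
  proof -
    obtain s t where "s \<in> F" "t \<in> F" "(x, m) \<in> s" "(x, n) \<in> t"
      using mn by blast
    moreover obtain u where "u \<in> F" "s \<subseteq> u" "t \<subseteq> u"
      using directed calculation by blast
    moreover obtain \<psi> :: "'a \<Rightarrow> int" where "\<forall>(x, n)\<in>u. \<psi> x = n"
      using hom_on[OF \<open>u \<in> F\<close>] by blast
    ultimately have "\<psi> x = m" "\<psi> x = n"
      by auto
    then show ?thesis
      by simp
  qed
  define \<phi> where "\<phi> x = (THE n. (x, n) \<in> \<Union>F)" for x
  have \<phi>_eq: "\<phi> x = n" if "(x, n) \<in> \<Union>F" for x n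
    unfolding \<phi>_def using that unique by (intro the_equality)
  have "\<phi> \<in> hom G integer_group"
  proof (rule homI)
    fix x y assume xy: "x \<in> carrier G" "y \<in> carrier G"
    obtain s1 s2 s3 where s: "s1 \<in> F" "s2 \<in> F" "s3 \<in> F" "x \<in> Domain s1" "y \<in> Domain s2" "x \<otimes> y \<in> Domain s3"
      using meets xy m_closed by metis
    obtain t where "t \<in> F" "s1 \<subseteq> t" "s2 \<subseteq> t"
      using directed s by blast
    moreover then obtain u where u: "u \<in> F" "t \<subseteq> u" "s3 \<subseteq> u"
      using directed s by blast
    ultimately obtain k l m where klm: "(x, k) \<in> u" "(y, l) \<in> u" "(x \<otimes> y, m) \<in> u"
      using s by blast
    obtain K \<psi> where K: "Domain u \<subseteq> K" "\<psi> \<in> hom (G\<lparr>carrier := K\<rparr>) integer_group" "\<forall>(x, n)\<in>u. \<psi> x = n"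
      using hom_on[OF u(1)] by blast
    have "x \<in> K" "y \<in> K"
      using klm K(1) by auto
    then have "\<psi> (x \<otimes> y) = \<psi> x + \<psi> y"
      using hom_mult[OF K(2)] by simp
    moreover have "\<psi> x = k" "\<psi> y = l" "\<psi> (x \<otimes> y) = m"
      using K(3) klm by auto
    moreover have "\<phi> x = k" "\<phi> y = l" "\<phi> (x \<otimes> y) = m"
      using \<phi>_eq u klm by blast+
    ultimately show "\<phi> (x \<otimes> y) = \<phi> x \<otimes>\<^bsub>integer_group\<^esub> \<phi> y"
      by simp
  qed simp
  moreover have "\<phi> x = n" if "(x, n) \<in> p" for x n
    using that FP \<phi>_eq unfolding P_def by blast
  ultimately show ?thesis
    unfolding hom_extends_def by blast
qed

section \<open>Separability\<close>

text \<open>By purity, an \<open>n\<close>-th root of \<open>a\<close> in \<open>K\<close> gives one of the form \<open>a [^] m\<close>. Since \<open>K\<close> is free, a homomorphism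
  to \<open>\<int>\<close> not vanishing at \<open>a\<close> turns \<open>a [^] (m * n) = a\<close> into \<open>m * n = 1\<close>.\<close>

lemma locally_extendable_pure_generator:
  assumes free: "kappa_free aleph2 G" and H: "pure_subgroup H G"
    and a: "a \<in> H" "H = range (\<lambda>n :: int. a [^] n)" "a \<noteq> \<one>"
  shows "locally_extendable G {(a, 1)}"
  unfolding locally_extendable_def
proof (intro allI impI)
  fix K assume K: "subgroup K G \<and> |K| \<le>o aleph1 \<and> Domain {(a, 1 :: int)} \<subseteq> K"
  then have sub: "subgroup K G" and aK: "a \<in> K"
    by auto
  have freeK: "is_free_abelian (G\<lparr>carrier := K\<rparr>)"
    using free K unfolding kappa_free_def ordLess_aleph2_iff by blast
  let ?K = "G\<lparr>carrier := K\<rparr>"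
  have gK: "group ?K"
    by (rule group_subgroup[OF sub])
  obtain \<psi> where \<psi>: "\<psi> \<in> hom ?K integer_group" "\<psi> a \<noteq> 0"
    using free_abelian_hom_nonzero[OF gK freeK, of a] aK a(3) by auto
  interpret \<psi>: group_hom ?K integer_group \<psi>
    using gK \<psi>(1) by (simp add: group_hom_def group_hom_axioms_def)
  have "n = 1" if b: "b \<in> carrier ?K" "b [^]\<^bsub>?K\<^esub> n = a" for b and n :: nat
  proof -
    have "b \<in> carrier G" "b [^] n = a"
      using b subgroup.subset[OF sub] by (auto simp: nat_pow_consistent[symmetric])
    then obtain h where h: "h \<in> H" "h [^] n = a"
      using H a(1) unfolding pure_subgroup_def by blast
    then obtain m :: int where "h = a [^] m"
      using a(2) by blast
    with h have m: "(a [^] m) [^] n = a"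
      by simp
    have "a [^] m = a [^]\<^bsub>?K\<^esub> m"
      using int_pow_consistent[OF sub aK] by simp
    moreover have "(a [^] m) [^] n = (a [^] m) [^]\<^bsub>?K\<^esub> n"
      by (simp add: nat_pow_consistent[symmetric])
    ultimately have "(a [^]\<^bsub>?K\<^esub> m) [^]\<^bsub>?K\<^esub> n = a"
      using m by simp
    then have "\<psi> a = \<psi> ((a [^]\<^bsub>?K\<^esub> m) [^]\<^bsub>?K\<^esub> n)"
      by simp
    also have "\<dots> = int n * (m * \<psi> a)"
    proof -
      have a': "a \<in> carrier ?K"
        using aK by simp
      have "a [^]\<^bsub>?K\<^esub> m \<in> carrier ?K"
        by (rule group.int_pow_closed[OF gK a'])
      then show ?thesis
        using \<psi>.hom_nat_pow \<psi>.hom_int_pow[OF a'] by simp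
    qed
    finally have "int n * m = 1"
      using \<psi>(2) by simp
    then show ?thesis
      by (auto simp: zmult_eq_1_iff)
  qed
  with free_abelian_unimodular[OF gK freeK] aK show "hom_extends ?K {(a, 1)}"
    unfolding hom_extends_def by simp
qed

lemma direct_summand_of_hom:
  assumes H: "subgroup H G" "H = range (\<lambda>n :: int. a [^] n)" and a: "a \<in> carrier G"
    and \<phi>: "\<phi> \<in> hom G integer_group" "\<phi> a = 1"
  shows "direct_summand H G"
proof -
  interpret \<phi>: group_hom G integer_group \<phi>
    using \<phi>(1) by (simp add: group_hom_def group_hom_axioms_def is_group)
  define K where "K = {x \<in> carrier G. \<phi> x = 0}"
  have \<phi>_pow: "\<phi> (a [^] n) = n" for n :: int
    using a \<phi>(2) by (simp add: \<phi>.hom_int_pow)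
  have "subgroup K G"
    using \<phi>.subgroup_kernel by (simp add: K_def kernel_def)
  moreover have "H \<inter> K = {\<one>}"
  proof
    show "H \<inter> K \<subseteq> {\<one>}"
      using H(2) \<phi>_pow by (auto simp: K_def)
    show "{\<one>} \<subseteq> H \<inter> K"
      using H(1) \<open>subgroup K G\<close> by (simp add: subgroup.one_closed)
  qed
  moreover have "H <#> K = carrier G"
  proof
    show "H <#> K \<subseteq> carrier G"
      using H(1) \<open>subgroup K G\<close> by (meson set_mult_closed subgroup.subset)
    show "carrier G \<subseteq> H <#> K"
    proof
      fix x assume x: "x \<in> carrier G"
      have "inv (a [^] \<phi> x) \<otimes> x \<in> K"
        using x a \<phi>_pow by (simp add: K_def)
      moreover have "x = a [^] \<phi> x \<otimes> (inv (a [^] \<phi> x) \<otimes> x)"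
        using x a by (simp flip: m_assoc)
      ultimately show "x \<in> H <#> K"
        using H(2) unfolding set_mult_def by blast
    qed
  qed
  ultimately show ?thesis
    using H(1) unfolding direct_summand_def by blast
qed

end

theorem theorem5p1:
  fixes G :: "('a, 'b) monoid_scheme"
  assumes "martins_axiom"
    and "comm_group G"
    and "kappa_free aleph2 G"
    and "|carrier G| <o continuum"
  shows "separable_group G"
proof -
  interpret comm_group G
    by fact
  have "kappa_free aleph1 G"
    using assms(3) unfolding kappa_free_def ordLess_aleph2_iff by (blast intro: ordLess_imp_ordLeq)
  moreover have "direct_summand H G" if H: "pure_subgroup H G" and cyclic: "cyclic_group (G\<lparr>carrier := H\<rparr>)" for H
  proof -
    have sub: "subgroup H G"
      using H by (simp add: pure_subgroup_def)
    obtain a where a: "a \<in> H" "H = range (\<lambda>n :: int. a [^]\<^bsub>G\<^esub> n)"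
    proof -
      obtain a where a: "a \<in> H" "H = range (\<lambda>n :: int. a [^]\<^bsub>G\<lparr>carrier := H\<rparr>\<^esub> n)"
        using cyclic unfolding group.cyclic_group[OF group_subgroup[OF sub]] by auto
      have "(\<lambda>n :: int. a [^]\<^bsub>G\<lparr>carrier := H\<rparr>\<^esub> n) = (\<lambda>n. a [^]\<^bsub>G\<^esub> n)"
        using int_pow_consistent[OF sub a(1)] by (intro ext) simp
      with a show ?thesis
        by (intro that) simp_all
    qed
    show ?thesis
    proof (cases "a = \<one>\<^bsub>G\<^esub>")
      case True
      then have "H = {\<one>\<^bsub>G\<^esub>}"
        using a by auto
      then show ?thesis
        unfolding direct_summand_def
        using sub subgroup_self by (intro conjI exI[of _ "carrier G"]) (auto simp: set_mult_def)
    next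
      case False
      have "hom_extends G {(a, 1)}"
        using martins_axiom_hom_extends[OF assms(1,3,4)] a sub
          locally_extendable_pure_generator[OF assms(3) H a False] subgroup.mem_carrier
        by (auto simp: subgroup.mem_carrier)
      then show ?thesis
        using direct_summand_of_hom[OF sub a(2)] a(1) subgroup.mem_carrier[OF sub]
        unfolding hom_extends_def by auto
    qed
  qed
  ultimately show ?thesis
    by (simp add: separable_group_def)
qed

end
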